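(* Let $t>0$, and for $0<\beta<1$ and $h>0$ let $G_\beta(x,\xi,t,h)$ be the leading-term regularized fundamental solution, defined in the context, of the degenerate parabolic equation $\frac{\partial u}{\partial t}-h x^2\frac{\partial^2 u}{\partial x^2}=0$ on $\mathbb{R}$ (Hamiltonian $H(x,p)=x^2p^2$). Then the following relations hold in the sense of distributions. (1) For every $h>0$, $$\lim_{\beta\to 1-0} G_\beta(0,\xi,t,h)=\delta(\xi)$$ as distributions in $\xi\in\mathbb{R}$, i.e. $\lim_{\beta\to1-0}\int_{-\infty}^{\infty}G_\beta(0,\xi,t,h)\psi(\xi)\,d\xi=\psi(0)$ for every test function $\psi\in C_0^\infty(\mathbb{R})$. (2) For every test function $\psi\in C_0^\infty(\mathbb{R})$, $$\lim_{\beta\to 1-0}\int_{-\infty}^{\infty}\psi(x)\,G_\beta(x,0,t,h)\,dx=\psi(0)\,(1+O(h)),$$ where $O(h)$ is understood as $h\to +0$ with $t$ fixed.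
   Context: Here $\delta$ is the Dirac delta function, $h>0$ is a small parameter, and $\beta\to1-0$ means $\beta$ tends to $1$ from below. **Definition of $G_\beta$.** Let $H(x,p)=x^2p^2$, $0<\beta<1$, $\xi\in\mathbb{R}$. For $x_0,y\in\mathbb{R}$ consider the Hamilton system $\dot x=H_p=2x^2p$, $\dot p=-H_x=-2xp^2$ with initial data $x|_{t=0}=x_0$, $p|_{t=0}=\beta(x_0-\xi-y)$. Its solution is $$x(x_0,\xi,y,t)=x_0e^{2\beta x_0(x_0-\xi-y)t},\qquad p=\beta(x_0-\xi-y)e^{-2\beta x_0(x_0-\xi-y)t}.$$ The system is extended by the constants of motion $y$ and $p_y=-\beta(x_0-\xi-y)$. Let $$\Phi_\beta=\frac{\beta(x_0-\xi-y)^2}{2}+\int_0^t(pH_p-H)\,d\tau$$ be the phase (the solution, expressed through $x_0$, of $\partial_t\Phi_\beta+x^2(\partial_x\Phi_\beta)^2=0$, $\Phi_\beta|_{t=0}=\beta(x-\xi-y)^2/2$), and let $$J=\frac{\partial(x,\,y-p_y)}{\partial(x_0,\,y)}$$ be the Jacobian determinant. Given $(x,\xi,t)$, let $x_0=x_0(x,\xi,\beta,t)$ and $\hat y=\hat y(x,\xi,\beta,t)$ be determined by the system $x(x_0,\xi,y,t)=x$, $y=p_y$. Then $$G_\beta(x,\xi,t,h)=\frac{1}{\sqrt{2\pi h}}\,\frac{1}{\sqrt{J}}\,\exp\Big(\frac1h\Big(\frac{\hat y^2}{2}-\Phi_\beta\Big)\Big)\,\exp\Big(\frac12\int_0^tH_{xp}\,d\tau\Big),$$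 where everything on the right is evaluated at $(x_0,y)=(x_0(x,\xi,\beta,t),\hat y(x,\xi,\beta,t))$ and along the corresponding trajectory. **Explicit form.** The equation $y=p_y$ gives $\hat y=-\frac{\beta(x_0-\xi)}{1-\beta}$, so $x_0$ is determined by $$x=x_0\exp\Big(\frac{2\beta t\,x_0(x_0-\xi)}{1-\beta}\Big),$$ and, at the corresponding $x_0$, $$G_\beta=\frac{1}{\sqrt{2\pi h}\,\sqrt J}\exp\Big(-\frac1h\Big[\frac{\beta(x_0-\xi)^2}{2(1-\beta)}+\frac{t\beta^2x_0^2(x_0-\xi)^2}{(1-\beta)^2}\Big]\Big)\exp\Big(\frac{2\beta t\,x_0(x_0-\xi)}{1-\beta}\Big),$$ $$J=\exp\Big(\frac{2\beta t\,x_0(x_0-\xi)}{1-\beta}\Big)\big(1-\beta+2\beta t(2x_0^2-x_0\xi)\big).$$ Only two cases are needed: $x=0$ (arbitrary $\xi$), where $x_0=0$ and $J=1-\beta$; and $\xi=0$ (arbitrary $x$), where $x_0\mapsto x$ is a smooth increasing bijection of $\mathbb{R}$ and $J>0$. *)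

theory Defs
  imports "HOL-Analysis.Analysis" "HOL-Library.Landau_Symbols"
begin

section \<open>Test functions\<close>

definition test_function :: "(real \<Rightarrow> real) \<Rightarrow> bool" where
  "test_function \<psi> \<longleftrightarrow>
     (\<forall>n x. (deriv ^^ n) \<psi> differentiable (at x)) \<and> compact (closure {x. \<psi> x \<noteq> 0})"

section \<open>The Hamiltonian and its trajectories\<close>

definition Ham :: "real \<Rightarrow> real \<Rightarrow> real" where
  "Ham x p = x\<^sup>2 * p\<^sup>2"

definition Ham_x :: "real \<Rightarrow> real \<Rightarrow> real" where
  "Ham_x x p = deriv (\<lambda>x'. Ham x' p) x"

definition Ham_p :: "real \<Rightarrow> real \<Rightarrow> real" where
  "Ham_p x p = deriv (\<lambda>p'. Ham x p') p"

definition Ham_xp :: "real \<Rightarrow> real \<Rightarrow> real" where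
  "Ham_xp x p = deriv (\<lambda>p'. Ham_x x p') p"

definition traj_x :: "real \<Rightarrow> real \<Rightarrow> real \<Rightarrow> real \<Rightarrow> real \<Rightarrow> real" where
  "traj_x \<beta> x0 \<xi> y \<tau> = x0 * exp (2 * \<beta> * x0 * (x0 - \<xi> - y) * \<tau>)"

definition traj_p :: "real \<Rightarrow> real \<Rightarrow> real \<Rightarrow> real \<Rightarrow> real \<Rightarrow> real" where
  "traj_p \<beta> x0 \<xi> y \<tau> = \<beta> * (x0 - \<xi> - y) * exp (- 2 * \<beta> * x0 * (x0 - \<xi> - y) * \<tau>)"

text \<open>Solutions on the time interval from 0 to \<open>T\<close>; the lemmas below show that
  (\<^const>\<open>traj_x\<close>, \<^const>\<open>traj_p\<close>) is the unique one with the prescribed initial data.\<close>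

definition hamilton_solution ::
  "real \<Rightarrow> real \<Rightarrow> real \<Rightarrow> (real \<Rightarrow> real) \<Rightarrow> (real \<Rightarrow> real) \<Rightarrow> bool" where
  "hamilton_solution T x0 p0 X P \<longleftrightarrow> X 0 = x0 \<and> P 0 = p0 \<and>
     (\<forall>\<tau>\<in>{0..T}. (X has_real_derivative Ham_p (X \<tau>) (P \<tau>)) (at \<tau> within {0..T}) \<and>
                 (P has_real_derivative - Ham_x (X \<tau>) (P \<tau>)) (at \<tau> within {0..T}))"

lemma Ham_p_eq: "Ham_p x p = 2 * x\<^sup>2 * p"
  unfolding Ham_p_def Ham_def
  by (rule DERIV_imp_deriv) (auto intro!: derivative_eq_intros)

lemma Ham_x_eq: "Ham_x x p = 2 * x * p\<^sup>2"
  unfolding Ham_x_def Ham_def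
  by (rule DERIV_imp_deriv) (auto intro!: derivative_eq_intros)

lemma traj_solves:
  "hamilton_solution T x0 (\<beta> * (x0 - \<xi> - y)) (traj_x \<beta> x0 \<xi> y) (traj_p \<beta> x0 \<xi> y)"
proof -
  define c where "c = \<beta> * (x0 - \<xi> - y)"
  have X: "traj_x \<beta> x0 \<xi> y = (\<lambda>\<tau>. x0 * exp (2 * x0 * c * \<tau>))"
    and P: "traj_p \<beta> x0 \<xi> y = (\<lambda>\<tau>. c * exp (- (2 * x0 * c * \<tau>)))"
    by (auto simp: traj_x_def traj_p_def c_def fun_eq_iff mult_ac)
  have E: "exp (2 * x0 * c * \<tau>) * exp (- (2 * x0 * c * \<tau>)) = 1" for \<tau>
    by (simp flip: exp_add)
  have "Ham_p (x0 * exp (2 * x0 * c * \<tau>)) (c * exp (- (2 * x0 * c * \<tau>)))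
      = 2 * x0 * c * x0 * exp (2 * x0 * c * \<tau>)" for \<tau>
    unfolding Ham_p_eq using E[of \<tau>] by algebra
  then have "((\<lambda>\<tau>. x0 * exp (2 * x0 * c * \<tau>)) has_real_derivative
      Ham_p (x0 * exp (2 * x0 * c * \<tau>)) (c * exp (- (2 * x0 * c * \<tau>)))) (at \<tau> within S)" for \<tau> S
    by (auto intro!: derivative_eq_intros)
  moreover have "Ham_x (x0 * exp (2 * x0 * c * \<tau>)) (c * exp (- (2 * x0 * c * \<tau>)))
      = 2 * x0 * c * c * exp (- (2 * x0 * c * \<tau>))" for \<tau>
    unfolding Ham_x_eq using E[of \<tau>] by algebra
  then have "((\<lambda>\<tau>. c * exp (- (2 * x0 * c * \<tau>))) has_real_derivative
      - Ham_x (x0 * exp (2 * x0 * c * \<tau>)) (c * exp (- (2 * x0 * c * \<tau>)))) (at \<tau> within S)" for \<tau> S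
    by (auto intro!: derivative_eq_intros)
  ultimately show ?thesis
    by (simp add: hamilton_solution_def X P c_def)
qed

lemma hamilton_solution_unique:
  assumes sol: "hamilton_solution T x0 (\<beta> * (x0 - \<xi> - y)) X P" and \<tau>: "\<tau> \<in> {0..T}"
  shows "X \<tau> = traj_x \<beta> x0 \<xi> y \<tau> \<and> P \<tau> = traj_p \<beta> x0 \<xi> y \<tau>"
proof -
  define c where "c = x0 * (\<beta> * (x0 - \<xi> - y))"
  have init: "X 0 = x0" "P 0 = \<beta> * (x0 - \<xi> - y)"
    and dX: "\<And>s. s \<in> {0..T} \<Longrightarrow> (X has_real_derivative 2 * (X s)\<^sup>2 * P s) (at s within {0..T})"
    and dP: "\<And>s. s \<in> {0..T} \<Longrightarrow> (P has_real_derivative - (2 * X s * (P s)\<^sup>2)) (at s within {0..T})"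
    using sol by (auto simp: hamilton_solution_def Ham_p_eq Ham_x_eq)
  have const: "f s = f 0"
    if "\<And>s. s \<in> {0..T} \<Longrightarrow> (f has_real_derivative 0) (at s within {0..T})" "s \<in> {0..T}"
    for f :: "real \<Rightarrow> real" and s
  proof -
    have "\<exists>k. \<forall>x\<in>{0..T}. f x = k"
      using that(1) by (intro has_field_derivative_zero_constant) auto
    with that(2) show ?thesis by force
  qed
  have XP: "X s * P s = c" if "s \<in> {0..T}" for s
  proof -
    have "X s * P s = X 0 * P 0"
    proof (rule const[of "\<lambda>s. X s * P s", OF _ that])
      fix s assume s: "s \<in> {0..T}"
      show "((\<lambda>s. X s * P s) has_real_derivative 0) (at s within {0..T})"
        by (rule derivative_eq_intros dX[OF s] dP[OF s])+ (simp add: power2_eq_square)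
    qed
    then show ?thesis by (simp add: init c_def)
  qed
  have "X \<tau> * exp (- (2 * c * \<tau>)) = X 0 * exp (- (2 * c * 0))"
  proof (rule const[of "\<lambda>s. X s * exp (- (2 * c * s))", OF _ \<tau>])
    fix s assume s: "s \<in> {0..T}"
    show "((\<lambda>s. X s * exp (- (2 * c * s))) has_real_derivative 0) (at s within {0..T})"
      by (rule derivative_eq_intros dX[OF s] refl)+
         (simp add: power2_eq_square flip: XP[OF s])
  qed
  moreover have "P \<tau> * exp (2 * c * \<tau>) = P 0 * exp (2 * c * 0)"
  proof (rule const[of "\<lambda>s. P s * exp (2 * c * s)", OF _ \<tau>])
    fix s assume s: "s \<in> {0..T}"
    show "((\<lambda>s. P s * exp (2 * c * s)) has_real_derivative 0) (at s within {0..T})"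
      by (rule derivative_eq_intros dP[OF s] refl)+
         (simp add: power2_eq_square flip: XP[OF s])
  qed
  ultimately have "X \<tau> = x0 * exp (2 * c * \<tau>)" "P \<tau> = \<beta> * (x0 - \<xi> - y) * exp (- (2 * c * \<tau>))"
    by (auto simp: init exp_minus field_simps)
  then show ?thesis
    by (simp add: traj_x_def traj_p_def c_def mult_ac)
qed

section \<open>Phase, Jacobian and the function G\<close>

text \<open>The momentum dual to \<open>y\<close>; like \<open>y\<close>, it is a constant of motion.\<close>

definition p_y :: "real \<Rightarrow> real \<Rightarrow> real \<Rightarrow> real \<Rightarrow> real" where
  "p_y \<beta> x0 \<xi> y = - \<beta> * (x0 - \<xi> - y)"

definition phase :: "real \<Rightarrow> real \<Rightarrow> real \<Rightarrow> real \<Rightarrow> real \<Rightarrow> real" where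
  "phase \<beta> x0 \<xi> y t =
     \<beta> * (x0 - \<xi> - y)\<^sup>2 / 2 +
     integral {0..t} (\<lambda>\<tau>. let X = traj_x \<beta> x0 \<xi> y \<tau>; P = traj_p \<beta> x0 \<xi> y \<tau>
                          in P * Ham_p X P - Ham X P)"

text \<open>Jacobian determinant of \<open>(f, g)\<close> with respect to its two real arguments.\<close>

definition jacobian2 ::
  "(real \<Rightarrow> real \<Rightarrow> real) \<Rightarrow> (real \<Rightarrow> real \<Rightarrow> real) \<Rightarrow> real \<Rightarrow> real \<Rightarrow> real" where
  "jacobian2 f g a b =
     deriv (\<lambda>u. f u b) a * deriv (\<lambda>v. g a v) b - deriv (\<lambda>v. f a v) b * deriv (\<lambda>u. g u b) a"

definition J :: "real \<Rightarrow> real \<Rightarrow> real \<Rightarrow> real \<Rightarrow> real \<Rightarrow> real" where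
  "J \<beta> x0 \<xi> y t =
     jacobian2 (\<lambda>x0' y'. traj_x \<beta> x0' \<xi> y' t) (\<lambda>x0' y'. y' - p_y \<beta> x0' \<xi> y') x0 y"

text \<open>The point \<open>(x\<^sub>0, y)\<close> is specified by a definite description. For general
  \<open>(x, \<xi>)\<close> the defining system need not have exactly one solution, and then \<open>G\<close> below is
  unspecified; for \<open>0 < \<beta> < 1\<close> and \<open>t > 0\<close> it has exactly one when \<open>x = 0\<close> or \<open>\<xi> = 0\<close>.\<close>

definition base_point :: "real \<Rightarrow> real \<Rightarrow> real \<Rightarrow> real \<Rightarrow> real \<times> real" where
  "base_point \<beta> x \<xi> t =
     (THE (x0, y). traj_x \<beta> x0 \<xi> y t = x \<and> y = p_y \<beta> x0 \<xi> y)"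

definition G :: "real \<Rightarrow> real \<Rightarrow> real \<Rightarrow> real \<Rightarrow> real \<Rightarrow> real" where
  "G \<beta> x \<xi> t h =
     (let (x0, y) = base_point \<beta> x \<xi> t in
        1 / sqrt (2 * pi * h) * (1 / sqrt (J \<beta> x0 \<xi> y t)) *
        exp (1 / h * (y\<^sup>2 / 2 - phase \<beta> x0 \<xi> y t)) *
        exp (1 / 2 * integral {0..t} (\<lambda>\<tau>. Ham_xp (traj_x \<beta> x0 \<xi> y \<tau>) (traj_p \<beta> x0 \<xi> y \<tau>))))"

end

(* Rescaling the starting point of the trajectory, \<xi> = sqrt (1 - \<beta>) s when x = 0 and
   x\<^sub>0 = sqrt (1 - \<beta>) s when \<xi> = 0, removes the singularity at \<beta> = 1: since dx/dx\<^sub>0 = J / (1 - \<beta>)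
   when \<xi> = 0, both pairings become integrals of the test function at a point tending to 0
   against a density with a limit and a Gaussian majorant of variance 2h, so dominated
   convergence applies. The limit density is the Gaussian of variance h in the first case, and in
   the second that Gaussian times exp (3ts\<^sup>2) sqrt (1 + 4ts\<^sup>2) exp (- ts\<^sup>4 / h), of total mass 1 + O(h). *)
theory Submission
  imports Defs "HOL-Probability.Distributions"
begin

section \<open>Integration on the real line\<close>

text \<open>A one-sided limit at \<open>a\<close> may be tested on sequences between
  \<open>b\<close> and \<open>a\<close>, and dominated convergence applies along each of
  them.\<close>

lemma tendsto_integral_at_left:
  fixes f :: "real \<Rightarrow> 'a \<Rightarrow> real"
  assumes "b < a"
    and meas: "\<And>\<beta>. b < \<beta> \<Longrightarrow> \<beta> < a \<Longrightarrow> f \<beta> \<in> borel_measurable M" "F \<in> borel_measurable M"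
    and lim: "\<And>s. ((\<lambda>\<beta>. f \<beta> s) \<longlongrightarrow> F s) (at_left a)"
    and w: "integrable M w" "\<And>\<beta> s. b < \<beta> \<Longrightarrow> \<beta> < a \<Longrightarrow> \<bar>f \<beta> s\<bar> \<le> w s"
  shows "((\<lambda>\<beta>. integral\<^sup>L M (f \<beta>)) \<longlongrightarrow> integral\<^sup>L M F) (at_left a)"
proof (rule tendsto_at_left_sequentially[OF \<open>b < a\<close>])
  fix S :: "nat \<Rightarrow> real"
  assume S: "\<And>n. S n < a" "\<And>n. b < S n" "S \<longlonglongrightarrow> a"
  have "filterlim S (at_left a) sequentially"
    using S by (simp add: filterlim_at less_imp_neq)
  then have "(\<lambda>n. f (S n) s) \<longlonglongrightarrow> F s" for s
    using lim[of s] by (rule filterlim_compose[rotated])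
  with S w meas show "(\<lambda>n. integral\<^sup>L M (f (S n))) \<longlonglongrightarrow> integral\<^sup>L M F"
    by (intro integral_dominated_convergence[where w = w]) auto
qed

text \<open>The variable is changed for absolutely integrable functions in the gauge sense;
  returning to the Lebesgue integral requires \<open>f\<close> to be Borel measurable. This is
  recovered from the substituted integrand, which spares a direct argument for \<open>G\<close>,
  defined through a definite description.\<close>

lemma lborel_integral_substitution:
  fixes f g g' :: "real \<Rightarrow> real"
  assumes deriv: "\<And>s. (g has_real_derivative g' s) (at s)" and pos: "\<And>s. g' s > 0"
    and "surj g" and meas: "g' \<in> borel_measurable borel"
    and int: "integrable lborel (\<lambda>s. f (g s) * g' s)"
  shows "(LBINT x. f x) = (LBINT s. f (g s) * g' s)"
proof -
  let ?b = "LBINT s. f (g s) * g' s"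
  have mono: "strict_mono g"
    unfolding strict_mono_def by (metis DERIV_pos_imp_increasing deriv pos)
  then have "inj g"
    by (rule strict_mono_imp_inj_on)
  have g_inv: "g (inv g x) = x" for x
    using \<open>surj g\<close> by (simp add: surj_f_inv_f)
  have "mono (inv g)"
  proof (rule monoI)
    fix x y :: real assume "x \<le> y"
    then have "g (inv g x) \<le> g (inv g y)" by (simp add: g_inv)
    then show "inv g x \<le> inv g y" by (simp add: strict_mono_less_eq[OF mono])
  qed
  then have inv_meas: "inv g \<in> borel_measurable borel"
    by (rule borel_measurable_mono)
  \<comment> \<open>Dividing out \<open>g'\<close> makes \<open>f\<close> composed with
    \<open>g\<close> measurable; composing with the monotone inverse of \<open>g\<close> then gives
    \<open>f\<close>.\<close>
  have "(\<lambda>s. f (g s) * g' s / g' s) \<in> borel_measurable borel"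
    using borel_measurable_integrable[OF int] meas by (intro borel_measurable_divide) simp_all
  then have "(\<lambda>s. f (g s)) \<in> borel_measurable borel"
    using pos by (simp add: less_imp_neq[symmetric])
  from measurable_compose[OF inv_meas this] have f_meas: "f \<in> borel_measurable borel"
    by (simp add: g_inv)
  have "(\<lambda>s. \<bar>g' s\<bar> * f (g s)) absolutely_integrable_on UNIV"
    and "integral UNIV (\<lambda>s. \<bar>g' s\<bar> * f (g s)) = ?b"
    using int integral_lborel[OF int] pos
    by (simp_all add: abs_of_pos mult.commute set_integrable_def integrable_completion
        borel_measurable_integrable)
  then have "f absolutely_integrable_on UNIV" "integral UNIV f = ?b"
    using has_absolute_integral_change_of_variables_1'[of UNIV g g' f ?b] deriv \<open>inj g\<close> \<open>surj g\<close>
    by auto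
  moreover from this(1) have "integrable lborel f"
    using f_meas by (simp add: set_integrable_def integrable_completion)
  ultimately show ?thesis
    using integral_lborel by metis
qed

lemma normal_density_sqrt:
  "h > 0 \<Longrightarrow> normal_density 0 (sqrt h) s = 1 / sqrt (2 * pi * h) * exp (- s\<^sup>2 / (2 * h))"
  by (simp add: normal_density_def)

text \<open>Up to a constant factor, this is the majorant in both limits; \<open>sqrt 2\<close> is
  its total mass.\<close>

lemma normal_density_double_variance:
  assumes "h > 0"
  shows "sqrt 2 * normal_density 0 (sqrt (2 * h)) s = 1 / sqrt (2 * pi * h) * exp (- s\<^sup>2 / (4 * h))"
proof -
  have "2 * pi * (2 * h) = 2 * (2 * pi * h)" by simp
  then have sqrt_eq: "sqrt (2 * pi * (2 * h)) = sqrt 2 * sqrt (2 * pi * h)"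
    by (simp only: real_sqrt_mult)
  have four: "2 * (2 * h) = 4 * h" by simp
  have "normal_density 0 (sqrt (2 * h)) s = 1 / (sqrt 2 * sqrt (2 * pi * h)) * exp (- s\<^sup>2 / (4 * h))"
    by (rule normal_density_sqrt[of "2 * h" s, unfolded sqrt_eq four]) (use assms in simp)
  then show ?thesis by simp
qed

section \<open>Test functions\<close>

lemma test_function_isCont:
  assumes "test_function \<psi>" shows "isCont \<psi> x"
proof -
  have "(deriv ^^ 0) \<psi> differentiable (at x)"
    using assms unfolding test_function_def by blast
  then show ?thesis
    by (simp add: differentiable_imp_continuous_within)
qed

lemma test_function_bounded:
  assumes "test_function \<psi>" shows "\<exists>M\<ge>0. \<forall>x. \<bar>\<psi> x\<bar> \<le> M"
proof -
  let ?K = "closure {x. \<psi> x \<noteq> 0}"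
  have "compact ?K"
    using assms by (simp add: test_function_def)
  then have "bounded (\<psi> ` ?K)"
    using test_function_isCont[OF assms]
    by (intro compact_imp_bounded compact_continuous_image continuous_at_imp_continuous_on) auto
  then obtain M where M: "\<And>x. x \<in> ?K \<Longrightarrow> \<bar>\<psi> x\<bar> \<le> M"
    by (auto simp: bounded_iff)
  \<comment> \<open>The maximum with 0 covers an empty support, where \<open>M\<close> may be
    negative.\<close>
  have "\<bar>\<psi> x\<bar> \<le> max M 0" for x
  proof (cases "\<psi> x = 0")
    case False
    then have "x \<in> ?K" by (intro subsetD[OF closure_subset]) simp
    with M show ?thesis by (simp add: le_max_iff_disj)
  qed simp
  then show ?thesis by (intro exI[of _ "max M 0"]) auto
qed

lemma test_function_borel:
  assumes "test_function \<psi>" shows "\<psi> \<in> borel_measurable borel"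
  using test_function_isCont[OF assms]
  by (intro borel_measurable_continuous_onI continuous_at_imp_continuous_on) auto

section \<open>Explicit form of the regularized fundamental solution\<close>

lemma Ham_xp_eq: "Ham_xp x p = 4 * x * p"
  unfolding Ham_xp_def Ham_x_eq
  by (rule DERIV_imp_deriv) (auto intro!: derivative_eq_intros)

text \<open>The product \<open>x p\<close> is a constant of motion, so the time integrals below have
  constant integrands.\<close>

lemma traj_x_mult_traj_p: "traj_x \<beta> x0 \<xi> y \<tau> * traj_p \<beta> x0 \<xi> y \<tau> = \<beta> * x0 * (x0 - \<xi> - y)"
  by (simp add: traj_x_def traj_p_def mult_ac exp_minus)

lemma phase_eq:
  assumes "t \<ge> 0"
  shows "phase \<beta> x0 \<xi> y t = \<beta> * (x0 - \<xi> - y)\<^sup>2 / 2 + t * (\<beta> * x0 * (x0 - \<xi> - y))\<^sup>2"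
proof -
  have "P * Ham_p X P - Ham X P = (X * P)\<^sup>2" for X P
    by (simp add: Ham_p_eq Ham_def power2_eq_square algebra_simps)
  with assms show ?thesis
    by (simp add: phase_def Let_def traj_x_mult_traj_p)
qed

lemma integral_Ham_xp:
  assumes "t \<ge> 0"
  shows "integral {0..t} (\<lambda>\<tau>. Ham_xp (traj_x \<beta> x0 \<xi> y \<tau>) (traj_p \<beta> x0 \<xi> y \<tau>))
    = 4 * t * (\<beta> * x0 * (x0 - \<xi> - y))"
  using assms by (simp add: Ham_xp_eq mult.assoc traj_x_mult_traj_p)

text \<open>Stated for every \<open>y\<close>, since the partial derivatives are taken before
  \<open>y = p_y\<close> is imposed. In both cases needed, the bracket becomes a multiple of
  \<open>1 - \<beta>\<close>.\<close>

lemma J_eq: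
  "J \<beta> x0 \<xi> y t = exp (2 * \<beta> * t * x0 * (x0 - \<xi> - y)) *
     (1 - \<beta> + 2 * \<beta> * t * x0 * ((1 - \<beta>) * (2 * x0 - \<xi> - y) + \<beta> * x0))"
proof -
  let ?E = "exp (2 * \<beta> * t * x0 * (x0 - \<xi> - y))"
  have "deriv (\<lambda>u. traj_x \<beta> u \<xi> y t) x0 = ?E * (1 + 2 * \<beta> * t * x0 * (2 * x0 - \<xi> - y))"
    unfolding traj_x_def
    by (rule DERIV_imp_deriv) (auto intro!: derivative_eq_intros simp: algebra_simps)
  moreover have "deriv (\<lambda>v. traj_x \<beta> x0 \<xi> v t) y = - ?E * (2 * \<beta> * t * x0\<^sup>2)"
    unfolding traj_x_def
    by (rule DERIV_imp_deriv)
       (auto intro!: derivative_eq_intros simp: algebra_simps power2_eq_square)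
  moreover have "deriv (\<lambda>v. v - p_y \<beta> x0 \<xi> v) y = 1 - \<beta>" "deriv (\<lambda>u. y - p_y \<beta> u \<xi> y) x0 = \<beta>"
    unfolding p_y_def by (rule DERIV_imp_deriv; auto intro!: derivative_eq_intros)+
  ultimately show ?thesis
    unfolding J_def jacobian2_def by (simp only:) (simp add: algebra_simps power2_eq_square)
qed

lemma G_eq:
  assumes "base_point \<beta> x \<xi> t = (x0, y)" "t \<ge> 0"
  shows "G \<beta> x \<xi> t h = 1 / sqrt (2 * pi * h) * (1 / sqrt (J \<beta> x0 \<xi> y t)) *
     exp (1 / h * (y\<^sup>2 / 2 - \<beta> * (x0 - \<xi> - y)\<^sup>2 / 2 - t * (\<beta> * x0 * (x0 - \<xi> - y))\<^sup>2)) *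
     exp (2 * t * (\<beta> * x0 * (x0 - \<xi> - y)))"
  using assms by (simp add: G_def phase_eq integral_Ham_xp diff_diff_eq)

section \<open>Base point and value of \<open>G\<close> for \<open>x = 0\<close>\<close>

lemma p_y_fixpoint_iff:
  assumes "\<beta> < 1" shows "y = p_y \<beta> x0 \<xi> y \<longleftrightarrow> y = - \<beta> * (x0 - \<xi>) / (1 - \<beta>)"
  using assms by (auto simp: p_y_def field_simps)

text \<open>The exponential in \<open>traj_x\<close> never vanishes, so the endpoint 0 forces
  \<open>x0 = 0\<close>.\<close>

lemma base_point_zero:
  assumes "\<beta> < 1" shows "base_point \<beta> 0 \<xi> t = (0, \<beta> * \<xi> / (1 - \<beta>))"
  unfolding base_point_def p_y_fixpoint_iff[OF assms]
  by (rule the_equality) (auto simp: traj_x_def)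

text \<open>Here \<open>J = 1 - \<beta>\<close>, so \<open>1 / sqrt J\<close> cancels the factor
  \<open>sqrt (1 - \<beta>)\<close> and, up to normalization, a Gaussian of variance
  \<open>h / \<beta>\<close> remains.\<close>

lemma G_zero:
  assumes "0 < \<beta>" "\<beta> < 1" "t > 0" "h > 0"
  shows "G \<beta> 0 (sqrt (1 - \<beta>) * s) t h * sqrt (1 - \<beta>) =
    1 / sqrt (2 * pi * h) * exp (- \<beta> * s\<^sup>2 / (2 * h))"
proof -
  define c where "c = sqrt (1 - \<beta>)"
  \<comment> \<open>Expressing \<open>\<beta>\<close> through \<open>c\<close> turns the identity
    for the exponent into one between rational functions.\<close>
  have c: "c > 0" "\<beta> = 1 - c\<^sup>2"
    using assms by (auto simp: c_def)
  have "1 / h * ((\<beta> * (c * s) / (1 - \<beta>))\<^sup>2 / 2 - \<beta> * (0 - c * s - \<beta> * (c * s) / (1 - \<beta>))\<^sup>2 / 2)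
      = - \<beta> * s\<^sup>2 / (2 * h)"
    using c(1) assms(4) unfolding c(2)
    by (simp add: field_simps power2_eq_square)
  moreover have "J \<beta> 0 (c * s) (\<beta> * (c * s) / (1 - \<beta>)) t = c\<^sup>2"
    by (simp add: J_eq c)
  ultimately show ?thesis
    using c assms by (simp add: G_eq[OF base_point_zero] flip: c_def)
qed

section \<open>Base point and value of \<open>G\<close> for \<open>\<xi> = 0\<close>\<close>

text \<open>For \<open>\<xi> = 0\<close> put \<open>x\<^sub>0 = \<surd>(1-\<beta>) s\<close>. The following is the corresponding endpoint \<open>x\<close> of the
  trajectory; in the variable \<open>s\<close> the substituted integrand has a limit as \<open>\<beta> \<rightarrow> 1\<close>.\<close>

definition endpoint :: "real \<Rightarrow> real \<Rightarrow> real \<Rightarrow> real" where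
  "endpoint t \<beta> s = sqrt (1 - \<beta>) * s * exp (2 * \<beta> * t * s\<^sup>2)"

definition endpoint' :: "real \<Rightarrow> real \<Rightarrow> real \<Rightarrow> real" where
  "endpoint' t \<beta> s = sqrt (1 - \<beta>) * exp (2 * \<beta> * t * s\<^sup>2) * (1 + 4 * \<beta> * t * s\<^sup>2)"

lemma endpoint_deriv: "(endpoint t \<beta> has_real_derivative endpoint' t \<beta> s) (at s)"
  unfolding endpoint_def[abs_def] endpoint'_def
  by (auto intro!: derivative_eq_intros simp: algebra_simps power2_eq_square)

lemma endpoint'_pos:
  assumes "0 < \<beta>" "\<beta> < 1" "t > 0" shows "endpoint' t \<beta> s > 0"
  using assms by (auto simp: endpoint'_def intro!: mult_pos_pos add_pos_nonneg)

lemma endpoint_strict_mono: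
  assumes "0 < \<beta>" "\<beta> < 1" "t > 0" shows "strict_mono (endpoint t \<beta>)"
  unfolding strict_mono_def
  by (metis DERIV_pos_imp_increasing endpoint_deriv endpoint'_pos[OF assms])

text \<open>The exponential is at least 1, so for \<open>x \<ge> 0\<close> the point
  \<open>x / c\<close> is mapped to at least \<open>x\<close> and the intermediate value theorem
  applies; negative values follow because \<open>endpoint\<close> is odd.\<close>

lemma endpoint_surj:
  assumes "0 < \<beta>" "\<beta> < 1" "t > 0" shows "surj (endpoint t \<beta>)"
proof -
  define c where "c = sqrt (1 - \<beta>)"
  have c: "c > 0" using assms by (simp add: c_def)
  have *: "\<exists>s. endpoint t \<beta> s = x" if x: "x \<ge> 0" for x
  proof -
    have "x * 1 \<le> x * exp (2 * \<beta> * t * (x / c)\<^sup>2)"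
      using x assms by (intro mult_left_mono) auto
    then have "endpoint t \<beta> 0 \<le> x" "x \<le> endpoint t \<beta> (x / c)"
      using x c by (simp_all add: endpoint_def flip: c_def)
    then obtain s where "endpoint t \<beta> s = x"
      using IVT[of "endpoint t \<beta>" 0 x "x / c"] x c DERIV_isCont[OF endpoint_deriv] by auto
    then show ?thesis ..
  qed
  have "\<exists>s. endpoint t \<beta> s = x" for x
  proof (cases "x \<ge> 0")
    case False
    with *[of "- x"] obtain s where "endpoint t \<beta> s = - x" by auto
    then have "endpoint t \<beta> (- s) = x" by (simp add: endpoint_def)
    then show ?thesis ..
  qed (use * in blast)
  then show ?thesis by (metis surjI)
qed

text \<open>With \<open>x0 = c * u\<close> and \<open>y\<close> eliminated, the trajectory ends at
  \<open>endpoint t \<beta> u\<close>; strict monotonicity then leaves only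
  \<open>u = s\<close>.\<close>

lemma base_point_endpoint:
  assumes "0 < \<beta>" "\<beta> < 1" "t > 0"
  shows "base_point \<beta> (endpoint t \<beta> s) 0 t = (sqrt (1 - \<beta>) * s, - \<beta> * s / sqrt (1 - \<beta>))"
proof -
  define c where "c = sqrt (1 - \<beta>)"
  have c: "c > 0" "1 - \<beta> = c\<^sup>2"
    using assms by (auto simp: c_def)
  have *: "traj_x \<beta> (c * u) 0 (- \<beta> * (c * u) / (1 - \<beta>)) t = endpoint t \<beta> u" for u
  proof -
    have "c * u - 0 - (- \<beta> * (c * u) / (1 - \<beta>)) = u / c"
      using c(1) unfolding c(2) by (simp add: field_simps power2_eq_square) (use c in algebra)
    then show ?thesis
      using c by (simp add: traj_x_def endpoint_def power2_eq_square mult_ac flip: c_def)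
  qed
  show ?thesis
    unfolding base_point_def p_y_fixpoint_iff[OF assms(2)] c_def[symmetric]
  proof (rule the_equality, goal_cases)
    case 1
    show ?case using *[of s] c by (simp add: power2_eq_square)
  next
    case (2 q)
    obtain x0 y where q: "q = (x0, y)" by fastforce
    with 2 have "endpoint t \<beta> (x0 / c) = endpoint t \<beta> s" and y: "y = - \<beta> * x0 / (1 - \<beta>)"
      using *[of "x0 / c"] c by auto
    then have "x0 / c = s"
      using strict_mono_eq[OF endpoint_strict_mono[OF assms]] by blast
    then have "x0 = c * s" using c by auto
    with y q c show ?case by (simp add: power2_eq_square)
  qed
qed

text \<open>In units of \<open>\<beta> * t * s\<^sup>2\<close>, the exponent 3 is 2 from the
  integral of \<open>Ham_xp\<close>, plus 2 from \<open>endpoint'\<close>, minus 1 from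
  \<open>1 / sqrt J\<close>. The square root is the polynomial factor of \<open>endpoint'\<close>
  divided by the root of the same factor in \<open>J\<close>; the last exponential is the time
  integral in the phase.\<close>

definition profile :: "real \<Rightarrow> real \<Rightarrow> real \<Rightarrow> real \<Rightarrow> real" where
  "profile t h \<beta> s = 1 / sqrt (2 * pi * h) * exp (- \<beta> * s\<^sup>2 / (2 * h)) *
     (exp (3 * \<beta> * t * s\<^sup>2) * sqrt (1 + 4 * \<beta> * t * s\<^sup>2) * exp (- t * \<beta>\<^sup>2 * (s\<^sup>2)\<^sup>2 / h))"

text \<open>The factor \<open>1 / sqrt J\<close> carries \<open>1 / c\<close> and
  \<open>endpoint'\<close> carries \<open>c\<close>, so the singularity at
  \<open>\<beta> = 1\<close> cancels.\<close>

lemma G_endpoint: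
  assumes "0 < \<beta>" "\<beta> < 1" "t > 0" "h > 0"
  shows "G \<beta> (endpoint t \<beta> s) 0 t h * endpoint' t \<beta> s = profile t h \<beta> s"
proof -
  define c where "c = sqrt (1 - \<beta>)"
  have c: "c > 0" "\<beta> = 1 - c\<^sup>2"
    using assms by (auto simp: c_def)
  define R where "R = 1 + 4 * \<beta> * t * s\<^sup>2"
  define E where "E = exp (\<beta> * t * s\<^sup>2)"
  have R: "R > 0" using assms by (auto simp: R_def intro!: add_pos_nonneg)
  have E: "E > 0" "exp (2 * \<beta> * t * s\<^sup>2) = E\<^sup>2" "exp (3 * \<beta> * t * s\<^sup>2) = E ^ 3"
    "exp (2 * t * (\<beta> * s\<^sup>2)) = E\<^sup>2"
    by (simp_all add: E_def algebra_simps flip: exp_of_nat_mult)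
  have d: "c * s - 0 - (- \<beta> * s / c) = s / c"
    using c(1) unfolding c(2) by (simp add: field_simps power2_eq_square)
  have J: "J \<beta> (c * s) 0 (- \<beta> * s / c) t = (E * c)\<^sup>2 * R"
  proof -
    have "(1 - \<beta>) * (2 * (c * s) - 0 - (- \<beta> * s / c)) + \<beta> * (c * s) = 2 * c * s"
      using c(1) unfolding c(2) by (simp add: field_simps power2_eq_square)
    then have "J \<beta> (c * s) 0 (- \<beta> * s / c) t =
        exp (2 * \<beta> * t * (c * s) * (s / c)) * (1 - \<beta> + 2 * \<beta> * t * (c * s) * (2 * c * s))"
      unfolding J_eq d by simp
    also have "2 * \<beta> * t * (c * s) * (s / c) = 2 * \<beta> * t * s\<^sup>2"
      using c by (simp add: power2_eq_square)
    also have "1 - \<beta> + 2 * \<beta> * t * (c * s) * (2 * c * s) = c\<^sup>2 * R"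
      unfolding R_def c(2) by (simp add: power2_eq_square algebra_simps)
    finally show ?thesis by (simp add: E power_mult_distrib)
  qed
  have sqrt_J: "sqrt ((E * c)\<^sup>2 * R) = E * c * sqrt R"
    using E(1) c(1) by (simp add: real_sqrt_mult)
  define Q where "Q = sqrt R"
  have Q: "Q > 0" "R = Q * Q"
    using R by (simp_all add: Q_def)
  \<comment> \<open>With \<open>X\<close> and \<open>Y\<close> standing for the two exponentials
    that contain \<open>h\<close>, only monomials remain to be cancelled.\<close>
  have cancel: "1 / A * (1 / (E * c * Q)) * (X * Y) * E\<^sup>2 * (c * E\<^sup>2 * (Q * Q))
      = 1 / A * X * (E ^ 3 * Q * Y)" for A X Y
    using Q(1) E(1) c(1) by (simp add: power2_eq_square power3_eq_cube)
  have x0: "\<beta> * (c * s) * (s / c) = \<beta> * s\<^sup>2"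
    using c by (simp add: power2_eq_square)
  have ph: "1 / h * ((- \<beta> * s / c)\<^sup>2 / 2 - \<beta> * (s / c)\<^sup>2 / 2 - t * (\<beta> * s\<^sup>2)\<^sup>2)
      = - \<beta> * s\<^sup>2 / (2 * h) + - t * \<beta>\<^sup>2 * (s\<^sup>2)\<^sup>2 / h"
    using c(1) assms(4) unfolding c(2)
    by (simp add: field_simps power2_eq_square)
  have "G \<beta> (endpoint t \<beta> s) 0 t h = 1 / sqrt (2 * pi * h) * (1 / (E * c * sqrt R)) *
     exp (- \<beta> * s\<^sup>2 / (2 * h) + - t * \<beta>\<^sup>2 * (s\<^sup>2)\<^sup>2 / h) * E\<^sup>2"
    unfolding G_eq[OF base_point_endpoint[OF assms(1-3), of s, folded c_def] less_imp_le[OF assms(3)]]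
      d J x0 ph E(4) sqrt_J ..
  then show ?thesis
    unfolding profile_def endpoint'_def exp_add E R_def[symmetric] c_def[symmetric]
    unfolding Q_def[symmetric] unfolding Q(2)
    by (simp only: cancel)
qed

section \<open>The limit profile\<close>

text \<open>The root of \<open>1 + a \<le> exp a\<close>; it lets the square root in
  \<open>profile\<close> be absorbed into an exponential.\<close>

lemma sqrt_one_plus_le_exp:
  fixes a :: real assumes "a \<ge> 0" shows "sqrt (1 + a) \<le> exp (a / 2)"
proof (rule real_le_lsqrt)
  show "1 + a \<le> (exp (a / 2))\<^sup>2"
    using exp_ge_add_one_self[of a] by (simp flip: exp_double)
qed auto

lemma profile_nonneg: "h > 0 \<Longrightarrow> \<beta> \<ge> 0 \<Longrightarrow> t \<ge> 0 \<Longrightarrow> profile t h \<beta> s \<ge> 0"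
  by (simp add: profile_def)

text \<open>The bound \<open>\<beta> \<ge> 1 / 2\<close> keeps the variance
  \<open>h / \<beta>\<close> at most \<open>2 * h\<close>.\<close>

lemma gaussian_le:
  assumes "1 / 2 \<le> \<beta>" "h > 0"
  shows "1 / sqrt (2 * pi * h) * exp (- \<beta> * s\<^sup>2 / (2 * h)) \<le> sqrt 2 * normal_density 0 (sqrt (2 * h)) s"
proof -
  have "1 / 2 * s\<^sup>2 \<le> \<beta> * s\<^sup>2"
    using assms by (intro mult_right_mono) auto
  then have "- \<beta> * s\<^sup>2 / (2 * h) \<le> - s\<^sup>2 / (4 * h)"
    using assms(2) by (simp add: field_simps)
  then show ?thesis
    using assms by (simp add: normal_density_double_variance divide_right_mono)
qed

text \<open>The quartic term of the exponent beats the quadratic growth, so the correction to the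
  Gaussian is bounded uniformly in \<open>s\<close> and \<open>\<beta>\<close>, for every
  \<open>h > 0\<close> and not only for small \<open>h\<close>.\<close>

lemma profile_le:
  assumes "1 / 2 \<le> \<beta>" "\<beta> \<le> 1" "h > 0" "t > 0"
  shows "profile t h \<beta> s \<le> exp (25 * t * h) * (sqrt 2 * normal_density 0 (sqrt (2 * h)) s)"
proof -
  let ?q = "s\<^sup>2"
  have 1: "\<beta> * t * ?q \<le> 1 * t * ?q"
    using assms by (intro mult_right_mono) auto
  have "(1 / 2)\<^sup>2 * (t * ?q\<^sup>2 / h) \<le> \<beta>\<^sup>2 * (t * ?q\<^sup>2 / h)"
    using assms by (intro mult_right_mono power_mono) auto
  then have 2: "- t * \<beta>\<^sup>2 * ?q\<^sup>2 / h \<le> - (t * ?q\<^sup>2 / (4 * h))"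
    by (simp add: power2_eq_square mult_ac)
  \<comment> \<open>Completing the square in \<open>?q\<close>: the coefficient 5 is 3 from the
    exponential plus 2 from the square root, and the quarter is the square of the lower bound for
    \<open>\<beta>\<close>.\<close>
  have "0 \<le> t * (?q - 10 * h)\<^sup>2 / (4 * h)"
    using assms by simp
  then have 3: "5 * t * ?q - t * ?q\<^sup>2 / (4 * h) \<le> 25 * t * h"
    using assms by (simp add: field_simps power2_eq_square)
  have "sqrt (1 + 4 * \<beta> * t * ?q) \<le> exp (2 * (\<beta> * t * ?q))"
    using sqrt_one_plus_le_exp[of "4 * \<beta> * t * ?q"] assms by (simp add: mult_ac)
  then have "exp (3 * \<beta> * t * ?q) * sqrt (1 + 4 * \<beta> * t * ?q) * exp (- t * \<beta>\<^sup>2 * ?q\<^sup>2 / h)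
      \<le> exp (3 * \<beta> * t * ?q) * exp (2 * (\<beta> * t * ?q)) * exp (- t * \<beta>\<^sup>2 * ?q\<^sup>2 / h)"
    by (intro mult_right_mono mult_left_mono) auto
  also have "\<dots> = exp (5 * (\<beta> * t * ?q) + - t * \<beta>\<^sup>2 * ?q\<^sup>2 / h)"
    by (simp flip: exp_add)
  also have "\<dots> \<le> exp (25 * t * h)"
    using 1 2 3 by simp
  finally have "exp (3 * \<beta> * t * ?q) * sqrt (1 + 4 * \<beta> * t * ?q) * exp (- t * \<beta>\<^sup>2 * ?q\<^sup>2 / h)
      \<le> exp (25 * t * h)" .
  from mult_mono[OF this gaussian_le[OF assms(1,3), of s]] show ?thesis
    unfolding profile_def using assms by (simp add: mult.commute)
qed

lemma endpoint_tendsto: "((\<lambda>\<beta>. endpoint t \<beta> s) \<longlongrightarrow> 0) (at_left 1)"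
  unfolding endpoint_def by (auto intro!: tendsto_eq_intros)

lemma profile_borel [measurable]: "profile t h \<beta> \<in> borel_measurable borel"
  unfolding profile_def[abs_def] by measurable

lemma profile_integrable:
  assumes "1 / 2 \<le> \<beta>" "\<beta> \<le> 1" "h > 0" "t > 0"
  shows "integrable lborel (profile t h \<beta>)"
proof (rule Bochner_Integration.integrable_bound)
  show "integrable lborel (\<lambda>s. exp (25 * t * h) * (sqrt 2 * normal_density 0 (sqrt (2 * h)) s))"
    using assms by simp
  show "AE s in lborel. norm (profile t h \<beta> s)
      \<le> norm (exp (25 * t * h) * (sqrt 2 * normal_density 0 (sqrt (2 * h)) s))"
    using profile_le[OF assms] profile_nonneg[of h \<beta> t] assms by (auto simp: abs_mult)
qed simp

text \<open>On the scale \<open>s\<^sup>2 \<sim> h\<close> of the Gaussian every correction factor is \<open>1 + O(h)\<close>; powers of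
  \<open>s\<^sup>2/h\<close> are absorbed by doubling the variance.\<close>

lemma profile_minus_normal_density_le:
  assumes "h > 0" "t > 0" "40 * t * h \<le> 1"
  shows "\<bar>profile t h 1 s - normal_density 0 (sqrt h) s\<bar>
    \<le> 104 * t * h * (sqrt 2 * normal_density 0 (sqrt (2 * h)) s)"
proof -
  let ?q = "s\<^sup>2"
  \<comment> \<open>The factor \<open>e\<^sup>2\<close> turns the exponent of variance
    \<open>h\<close> into that of variance \<open>2 * h\<close>, so \<open>F - 1\<close> may grow
    like \<open>e\<^sup>2\<close>.\<close>
  define e where "e = exp (?q / (8 * h))"
  define F where "F = exp (3 * t * ?q) * sqrt (1 + 4 * t * ?q) * exp (- (t * ?q\<^sup>2 / h))"
  have e: "e \<ge> 1" "e\<^sup>2 = exp (?q / (4 * h))"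
    using assms by (simp_all add: e_def flip: exp_double)
  have "?q / (8 * h) \<le> e"
    using exp_ge_add_one_self[of "?q / (8 * h)"] unfolding e_def by linarith
  then have q: "?q \<le> 8 * h * e"
    using assms by (simp add: field_simps)
  have q2: "?q\<^sup>2 / h \<le> 64 * h * e\<^sup>2"
    using power_mono[OF q, of 2] assms by (simp add: field_simps power2_eq_square)
  \<comment> \<open>The bound on \<open>h\<close> says that
    \<open>5 * t \<le> 1 / (8 * h)\<close>.\<close>
  have "40 * t * h * ?q \<le> 1 * ?q"
    using assms by (intro mult_right_mono) auto
  then have "exp (5 * t * ?q) \<le> e"
    using assms by (simp add: e_def field_simps)
  then have "5 * t * ?q * exp (5 * t * ?q) \<le> 5 * t * (8 * h * e) * e"
    using q e assms by (intro mult_mono) auto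
  \<comment> \<open>The upper estimate yields the constant 40 and the lower one 64;
    \<open>104 = 40 + 64\<close> covers both.\<close>
  also have "\<dots> \<le> 104 * t * h * e\<^sup>2"
    using assms by (simp add: power2_eq_square)
  finally have up: "5 * t * ?q * exp (5 * t * ?q) \<le> 104 * t * h * e\<^sup>2" .
  have "F \<le> exp (3 * t * ?q) * exp (2 * t * ?q) * 1"
    using sqrt_one_plus_le_exp[of "4 * t * ?q"] assms unfolding F_def
    by (intro mult_mono) (auto simp: mult.assoc)
  also have "\<dots> = exp (5 * t * ?q)"
    by (simp flip: exp_add)
  \<comment> \<open>This is \<open>1 - a \<le> exp (- a)\<close> multiplied by \<open>exp a\<close>,
    with \<open>a = 5 * t * ?q\<close>.\<close>
  also have "\<dots> \<le> 1 + 5 * t * ?q * exp (5 * t * ?q)"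
    using mult_right_mono[OF exp_ge_add_one_self[of "- (5 * t * ?q)"], of "exp (5 * t * ?q)"]
    by (simp add: algebra_simps flip: exp_add)
  finally have F_up: "F - 1 \<le> 104 * t * h * e\<^sup>2"
    using up by linarith
  \<comment> \<open>From below, only the quartic exponential matters: the other two factors are at
    least 1.\<close>
  have "1 * 1 * exp (- (t * ?q\<^sup>2 / h)) \<le> F"
    unfolding F_def using assms by (intro mult_mono) auto
  moreover have "1 - t * ?q\<^sup>2 / h \<le> exp (- (t * ?q\<^sup>2 / h))"
    using exp_ge_add_one_self[of "- (t * ?q\<^sup>2 / h)"] by simp
  moreover have "t * ?q\<^sup>2 / h \<le> t * (64 * h * e\<^sup>2)"
    using mult_left_mono[OF q2, of t] assms by simp
  moreover have "t * (64 * h * e\<^sup>2) \<le> 104 * t * h * e\<^sup>2"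
    using assms by simp
  ultimately have F_low: "- (104 * t * h * e\<^sup>2) \<le> F - 1"
    by linarith
  have "profile t h 1 s - normal_density 0 (sqrt h) s = normal_density 0 (sqrt h) s * (F - 1)"
    using assms by (simp add: profile_def normal_density_sqrt F_def algebra_simps)
  then have "\<bar>profile t h 1 s - normal_density 0 (sqrt h) s\<bar>
      \<le> normal_density 0 (sqrt h) s * (104 * t * h * e\<^sup>2)"
    using F_up F_low by (simp add: abs_mult mult_left_mono abs_le_iff)
  also have "\<dots> = 104 * t * h * (1 / sqrt (2 * pi * h) * (exp (- ?q / (2 * h)) * e\<^sup>2))"
    using assms by (simp add: normal_density_sqrt)
  also have "exp (- ?q / (2 * h)) * e\<^sup>2 = exp (- ?q / (4 * h))"
    using assms by (simp add: e field_simps flip: exp_add)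
  finally show ?thesis
    using assms by (simp add: normal_density_double_variance)
qed

text \<open>The Gaussian of variance \<open>h\<close> has mass 1, so the pointwise estimate can be
  integrated; its majorant contributes the mass \<open>sqrt 2\<close>.\<close>

lemma profile_mass:
  assumes "t > 0"
  shows "(\<lambda>h. (LBINT s. profile t h 1 s) - 1) \<in> O[at_right 0](\<lambda>h. h)"
proof (rule bigoI)
  have "\<forall>\<^sub>F h in at_right 0. 0 < h \<and> h < 1 / (40 * t)"
    using assms by (intro eventually_at_rightI[of 0 "1 / (40 * t)"]) auto
  then show "\<forall>\<^sub>F h in at_right 0. norm ((LBINT s. profile t h 1 s) - 1) \<le> 104 * t * sqrt 2 * norm h"
  proof eventually_elim
    case (elim h)
    then have h: "h > 0" "40 * t * h \<le> 1"
      using assms by (auto simp: field_simps)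
    have int: "integrable lborel (profile t h 1)" "integrable lborel (normal_density 0 (sqrt h))"
      using h assms by (auto intro: profile_integrable)
    have "(LBINT s. profile t h 1 s) - 1 = (LBINT s. profile t h 1 s - normal_density 0 (sqrt h) s)"
      using int h by simp
    also have "\<bar>\<dots>\<bar> \<le> (LBINT s. \<bar>profile t h 1 s - normal_density 0 (sqrt h) s\<bar>)"
      by (rule integral_abs_bound)
    also have "\<dots> \<le> (LBINT s. 104 * t * h * (sqrt 2 * normal_density 0 (sqrt (2 * h)) s))"
      using int h assms by (intro integral_mono profile_minus_normal_density_le) auto
    also have "\<dots> = 104 * t * h * sqrt 2"
      using h by simp
    finally show ?case
      using h by (simp add: mult_ac)
  qed
qed

section \<open>Both limits\<close>

lemma tendsto_pairing_G_zero:
  assumes "t > 0" "h > 0" and \<psi>: "test_function \<psi>"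
  shows "((\<lambda>\<beta>. LBINT \<xi>. G \<beta> 0 \<xi> t h * \<psi> \<xi>) \<longlongrightarrow> \<psi> 0) (at_left 1)"
proof -
  obtain M where M: "M \<ge> 0" "\<And>x. \<bar>\<psi> x\<bar> \<le> M"
    using test_function_bounded[OF \<psi>] by auto
  have [measurable]: "\<psi> \<in> borel_measurable borel"
    by (rule test_function_borel[OF \<psi>])
  \<comment> \<open>The rescaled \<open>G\<close> as given by \<open>G_zero\<close>.\<close>
  define w where "w = (\<lambda>\<beta> s. 1 / sqrt (2 * pi * h) * exp (- \<beta> * s\<^sup>2 / (2 * h)))"
  have "((\<lambda>\<beta>. LBINT s. w \<beta> s * \<psi> (sqrt (1 - \<beta>) * s))
      \<longlongrightarrow> (LBINT s. normal_density 0 (sqrt h) s * \<psi> 0)) (at_left 1)"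
  proof (rule tendsto_integral_at_left[of "1 / 2"])
    show "integrable lborel (\<lambda>s. sqrt 2 * normal_density 0 (sqrt (2 * h)) s * M)"
      using \<open>h > 0\<close> by simp
    fix s
    have "((\<lambda>\<beta>. sqrt (1 - \<beta>) * s) \<longlongrightarrow> 0) (at_left 1)"
      by (auto intro!: tendsto_eq_intros)
    then have "((\<lambda>\<beta>. \<psi> (sqrt (1 - \<beta>) * s)) \<longlongrightarrow> \<psi> 0) (at_left 1)"
      by (rule isCont_tendsto_compose[OF test_function_isCont[OF \<psi>]])
    moreover have "((\<lambda>\<beta>. w \<beta> s) \<longlongrightarrow> normal_density 0 (sqrt h) s) (at_left 1)"
      using \<open>h > 0\<close> by (auto simp: w_def normal_density_sqrt intro!: tendsto_eq_intros)
    ultimately show "((\<lambda>\<beta>. w \<beta> s * \<psi> (sqrt (1 - \<beta>) * s))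
        \<longlongrightarrow> normal_density 0 (sqrt h) s * \<psi> 0) (at_left 1)"
      by (intro tendsto_mult)
    fix \<beta> :: real assume "1 / 2 < \<beta>"
    then have "w \<beta> s \<le> sqrt 2 * normal_density 0 (sqrt (2 * h)) s" "w \<beta> s \<ge> 0"
      using gaussian_le[of \<beta> h s] \<open>h > 0\<close> by (auto simp: w_def)
    then show "\<bar>w \<beta> s * \<psi> (sqrt (1 - \<beta>) * s)\<bar> \<le> sqrt 2 * normal_density 0 (sqrt (2 * h)) s * M"
      unfolding abs_mult using M by (intro mult_mono) auto
  qed (auto simp: w_def)
  moreover have "\<forall>\<^sub>F \<beta> in at_left 1.
      (LBINT s. w \<beta> s * \<psi> (sqrt (1 - \<beta>) * s)) = (LBINT \<xi>. G \<beta> 0 \<xi> t h * \<psi> \<xi>)"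
  proof (rule eventually_at_leftI[of 0])
    fix \<beta> :: real assume "\<beta> \<in> {0<..<1}"
    then have \<beta>: "0 < \<beta>" "\<beta> < 1" by auto
    have eq: "w \<beta> s * \<psi> (sqrt (1 - \<beta>) * s) =
        sqrt (1 - \<beta>) * (G \<beta> 0 (sqrt (1 - \<beta>) * s) t h * \<psi> (sqrt (1 - \<beta>) * s))" for s
      unfolding w_def G_zero[OF \<beta> assms(1,2), symmetric] by (simp only: mult_ac)
    then show "(LBINT s. w \<beta> s * \<psi> (sqrt (1 - \<beta>) * s)) = (LBINT \<xi>. G \<beta> 0 \<xi> t h * \<psi> \<xi>)"
      using \<beta> lborel_integral_real_affine[of "sqrt (1 - \<beta>)" "\<lambda>\<xi>. G \<beta> 0 \<xi> t h * \<psi> \<xi>" 0]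
      unfolding eq by simp
  qed auto
  ultimately have "((\<lambda>\<beta>. LBINT \<xi>. G \<beta> 0 \<xi> t h * \<psi> \<xi>)
      \<longlongrightarrow> (LBINT s. normal_density 0 (sqrt h) s * \<psi> 0)) (at_left 1)"
    by (rule Lim_transform_eventually)
  then show ?thesis
    using \<open>h > 0\<close> by simp
qed

text \<open>The limit is exact for each \<open>h > 0\<close>; smallness of \<open>h\<close> enters
  only when the mass of the limit profile is estimated.\<close>

lemma tendsto_pairing_G:
  assumes "t > 0" "h > 0" and \<psi>: "test_function \<psi>"
  shows "((\<lambda>\<beta>. LBINT x. \<psi> x * G \<beta> x 0 t h) \<longlongrightarrow> \<psi> 0 * (LBINT s. profile t h 1 s)) (at_left 1)"
proof -
  obtain M where M: "M \<ge> 0" "\<And>x. \<bar>\<psi> x\<bar> \<le> M"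
    using test_function_bounded[OF \<psi>] by auto
  have [measurable]: "\<psi> \<in> borel_measurable borel"
    by (rule test_function_borel[OF \<psi>])
  have [measurable]: "endpoint t \<beta> \<in> borel_measurable borel"
    "endpoint' t \<beta> \<in> borel_measurable borel" for \<beta>
    unfolding endpoint_def[abs_def] endpoint'_def[abs_def] by measurable
  define w where "w = (\<lambda>s. M * (exp (25 * t * h) * (sqrt 2 * normal_density 0 (sqrt (2 * h)) s)))"
  have w: "integrable lborel w"
    using \<open>h > 0\<close> by (simp add: w_def)
  have bound: "\<bar>\<psi> (endpoint t \<beta> s) * profile t h \<beta> s\<bar> \<le> w s" if "1 / 2 < \<beta>" "\<beta> < 1" for \<beta> s
    unfolding w_def abs_mult using M that assms profile_le[of \<beta> h t s] profile_nonneg[of h \<beta> t s]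
    by (intro mult_mono) auto
  have "((\<lambda>\<beta>. LBINT s. \<psi> (endpoint t \<beta> s) * profile t h \<beta> s)
      \<longlongrightarrow> (LBINT s. \<psi> 0 * profile t h 1 s)) (at_left 1)"
  proof (rule tendsto_integral_at_left[of "1 / 2", OF _ _ _ _ w bound])
    fix s
    have "((\<lambda>\<beta>. \<psi> (endpoint t \<beta> s)) \<longlongrightarrow> \<psi> 0) (at_left 1)"
      by (rule isCont_tendsto_compose[OF test_function_isCont[OF \<psi>] endpoint_tendsto])
    moreover have "((\<lambda>\<beta>. profile t h \<beta> s) \<longlongrightarrow> profile t h 1 s) (at_left 1)"
      using \<open>h > 0\<close> unfolding profile_def by (auto intro!: tendsto_eq_intros)
    ultimately show "((\<lambda>\<beta>. \<psi> (endpoint t \<beta> s) * profile t h \<beta> s)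
        \<longlongrightarrow> \<psi> 0 * profile t h 1 s) (at_left 1)"
      by (intro tendsto_mult)
  qed auto
  moreover have "\<forall>\<^sub>F \<beta> in at_left 1.
      (LBINT s. \<psi> (endpoint t \<beta> s) * profile t h \<beta> s) = (LBINT x. \<psi> x * G \<beta> x 0 t h)"
  \<comment> \<open>Above \<open>1 / 2\<close> the majorant \<open>w\<close> also makes the
    substituted integrand integrable, as the change of variables requires.\<close>
  proof (rule eventually_at_leftI[of "1 / 2"])
    fix \<beta> :: real assume "\<beta> \<in> {1 / 2<..<1}"
    then have \<beta>: "0 < \<beta>" "1 / 2 < \<beta>" "\<beta> < 1" by auto
    have eq: "\<psi> (endpoint t \<beta> s) * G \<beta> (endpoint t \<beta> s) 0 t h * endpoint' t \<beta> s
        = \<psi> (endpoint t \<beta> s) * profile t h \<beta> s" for s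
      using G_endpoint[OF \<beta>(1,3) assms(1,2), of s] by simp
    have "integrable lborel (\<lambda>s. \<psi> (endpoint t \<beta> s) * profile t h \<beta> s)"
      by (rule Bochner_Integration.integrable_bound[OF w])
         (auto intro!: order_trans[OF bound[OF \<beta>(2,3)] abs_ge_self])
    then show "(LBINT s. \<psi> (endpoint t \<beta> s) * profile t h \<beta> s) = (LBINT x. \<psi> x * G \<beta> x 0 t h)"
      using lborel_integral_substitution[of "endpoint t \<beta>" "endpoint' t \<beta>" "\<lambda>x. \<psi> x * G \<beta> x 0 t h",
          OF endpoint_deriv endpoint'_pos endpoint_surj] \<beta> assms
      unfolding eq by simp
  qed auto
  ultimately have "((\<lambda>\<beta>. LBINT x. \<psi> x * G \<beta> x 0 t h)
      \<longlongrightarrow> (LBINT s. \<psi> 0 * profile t h 1 s)) (at_left 1)"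
    by (rule Lim_transform_eventually)
  then show ?thesis by simp
qed

theorem mainTheorem1:
  fixes t :: real
  assumes "t > 0"
  shows "(\<forall>h>0. \<forall>\<psi>. test_function \<psi> \<longrightarrow>
            ((\<lambda>\<beta>. LBINT \<xi>. G \<beta> 0 \<xi> t h * \<psi> \<xi>) \<longlongrightarrow> \<psi> 0) (at_left 1)) \<and>
         (\<forall>\<psi>. test_function \<psi> \<longrightarrow>
            (\<exists>r :: real \<Rightarrow> real. r \<in> O[at_right 0](\<lambda>h. h) \<and>
               (\<forall>h>0. ((\<lambda>\<beta>. LBINT x. \<psi> x * G \<beta> x 0 t h) \<longlongrightarrow> \<psi> 0 * (1 + r h)) (at_left 1))))"
proof (intro conjI allI impI)
  fix \<psi> assume \<psi>: "test_function \<psi>"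
  show "\<exists>r :: real \<Rightarrow> real. r \<in> O[at_right 0](\<lambda>h. h) \<and>
      (\<forall>h>0. ((\<lambda>\<beta>. LBINT x. \<psi> x * G \<beta> x 0 t h) \<longlongrightarrow> \<psi> 0 * (1 + r h)) (at_left 1))"
    using profile_mass[OF assms] tendsto_pairing_G[OF assms _ \<psi>]
    \<comment> \<open>The witness, the excess mass of the limit profile, is the same for every
      \<open>\<psi>\<close>.\<close>
    by (intro exI[of _ "\<lambda>h. (LBINT s. profile t h 1 s) - 1"]) simp
qed (rule tendsto_pairing_G_zero[OF assms])

end
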